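(* Let $m\ge 0$ be an integer and let $f:\mathbb{R}\to\mathbb{R}$ satisfy Fréchet's functional equation \[ \Delta_h^{m+1}f(x)=0\quad\text{for all }(x,h)\in\mathbb{R}^2 . \] Suppose that $f(x)$ is not an ordinary algebraic polynomial. Then $f$ is locally unbounded. Indeed, for each $x\in\mathbb{R}$ there exists an unbounded interval $I_x\subseteq\mathbb{R}$ such that $\{x\}\times I_x\subseteq\overline{G(f)}^{\mathbb{R}^2}$. Furthermore, $\overline{G(f)}^{\mathbb{R}^2}$ contains an unbounded open subset of $\mathbb{R}^2$.
   Context: For $f:\mathbb{R}\to\mathbb{R}$ and $h\in\mathbb{R}$, $\Delta_h^1 f(x)=f(x+h)-f(x)$ and $\Delta_h^{k+1}f(x)=\Delta_h^1(\Delta_h^k f)(x)$ for $k\ge1$; explicitly $\Delta_h^{m+1}f(x)=\sum_{k=0}^{m+1}\binom{m+1}{k}(-1)^{m+1-k}f(x+kh)$. An ordinary algebraic polynomial is a function given by a polynomial in $x$ with real coefficients. A function $f:\mathbb{R}\to\mathbb{R}$ is locally unbounded if it is unbounded on every non-empty open set $U\subseteq\mathbb{R}$. $G(f)=\{(x,f(x)):x\in\mathbb{R}\}\subseteq\mathbb{R}^2$ is the graph of $f$, and $\overline{G(f)}^{\mathbb{R}^2}$ is its closure in $\mathbb{R}^2$ (Euclidean topology). *)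

theory Defs
  imports "HOL-Analysis.Analysis" "HOL-Computational_Algebra.Polynomial"
begin

definition forward_diff :: "real \<Rightarrow> (real \<Rightarrow> real) \<Rightarrow> real \<Rightarrow> real" where
  "forward_diff h f = (\<lambda>x. f (x + h) - f x)"

text \<open>The iterated difference; the zeroth difference is \<open>f\<close> itself, so that the first one is
  \<^const>\<open>forward_diff\<close>.\<close>

primrec iter_diff :: "real \<Rightarrow> nat \<Rightarrow> (real \<Rightarrow> real) \<Rightarrow> real \<Rightarrow> real" where
  "iter_diff h 0 f = f"
| "iter_diff h (Suc k) f = forward_diff h (iter_diff h k f)"

definition ordinary_polynomial :: "(real \<Rightarrow> real) \<Rightarrow> bool" where
  "ordinary_polynomial f \<longleftrightarrow> (\<exists>p :: real poly. \<forall>x. f x = poly p x)"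

definition locally_unbounded :: "(real \<Rightarrow> real) \<Rightarrow> bool" where
  "locally_unbounded f \<longleftrightarrow> (\<forall>U. open U \<longrightarrow> U \<noteq> {} \<longrightarrow> \<not> bounded (f ` U))"

definition fun_graph :: "(real \<Rightarrow> real) \<Rightarrow> (real \<times> real) set" where
  "fun_graph f = {(x, f x) | x. x \<in> UNIV}"

end

theory Submission
  imports Defs
begin

text \<open>On every rational line \<open>x + \<rat>h\<close> a solution of Frechet's equation is a polynomial, by
  Newton's interpolation formula. Hence \<open>f (r + t h)\<close> is a polynomial in two variables for rational
  \<open>r, t\<close>, and by density the closure of the graph contains all points \<open>(s, F s v)\<close>, where \<open>F\<close> is this
  polynomial in the coordinates \<open>s = r + t h\<close>, \<open>v = t\<close>. If \<open>h\<close> is a point where \<open>f\<close> differs from the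
  polynomial that it agrees with on \<open>\<rat>\<close>, then \<open>F\<close> really depends on \<open>v\<close>. Its leading coefficient
  in \<open>v\<close> is a nonzero polynomial in \<open>s\<close>, so it has constant sign just to the right of any given
  \<open>s\<close>; there the values \<open>F s v\<close> fill a half-line starting at \<open>F s 0\<close>, always in the same
  direction.\<close>

section \<open>Newton's formula along arithmetic progressions\<close>

lemma binomial_polynomial:
  "\<exists>B :: real poly. \<forall>n::nat. poly B (of_nat n) = of_nat (n choose k)"
proof (intro exI allI)
  fix n :: nat
  show "poly (smult (1 / fact k) (\<Prod>i<k. [:- of_nat i, 1:])) (of_nat n) = (of_nat (n choose k) :: real)"
    by (simp add: binomial_gbinomial gbinomial_prod_rev poly_prod atLeast0LessThan)
qed

lemma poly_eqI_of_nat: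
  fixes p q :: "real poly"
  assumes "\<And>n::nat. poly p (of_nat n) = poly q (of_nat n)"
  shows "p = q"
proof (rule ccontr)
  assume "p \<noteq> q"
  then have "finite {x. poly (p - q) x = 0}"
    by (intro poly_roots_finite) simp
  moreover have "range (of_nat :: nat \<Rightarrow> real) \<subseteq> {x. poly (p - q) x = 0}"
    using assms by auto
  ultimately have "finite (range (of_nat :: nat \<Rightarrow> real))"
    by (rule rev_finite_subset)
  then show False
    by (auto dest!: finite_imageD simp: inj_of_nat)
qed

lemma iter_diff_Suc: "iter_diff h (Suc k) f x = iter_diff h k f (x + h) - iter_diff h k f x"
  by (simp add: forward_diff_def)

text \<open>Pascal's rule in summed form. The boundary term carries \<open>a (Suc m)\<close>, which
  is zero when \<open>a k\<close> is the k-th difference of a solution.\<close>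

lemma sum_binomial_Suc:
  fixes a :: "nat \<Rightarrow> real"
  shows "(\<Sum>k\<le>m. of_nat (n choose k) * (a k + a (Suc k)))
    = (\<Sum>k\<le>m. of_nat (Suc n choose k) * a k) + of_nat (n choose m) * a (Suc m)"
  by (induction m) (simp_all add: algebra_simps)

lemma newton_forward_diff:
  assumes "\<And>x. iter_diff h (Suc m) f x = 0"
  shows "f (x + of_nat n * h) = (\<Sum>k\<le>m. of_nat (n choose k) * iter_diff h k f x)"
proof (induction n arbitrary: x)
  case 0
  have "(\<Sum>k\<le>m. of_nat (0 choose k) * iter_diff h k f x)
    = (\<Sum>k\<le>m. if k = 0 then iter_diff h k f x else 0)"
    by (rule sum.cong) auto
  then show ?case by simp
next
  case (Suc n)
  have "f (x + of_nat (Suc n) * h) = f ((x + h) + of_nat n * h)"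
    by (simp add: algebra_simps)
  also have "\<dots> = (\<Sum>k\<le>m. of_nat (n choose k) * iter_diff h k f (x + h))"
    by (rule Suc.IH)
  also have "\<dots> = (\<Sum>k\<le>m. of_nat (n choose k) * (iter_diff h k f x + iter_diff h (Suc k) f x))"
    by (simp only: iter_diff_Suc) simp
  also have "\<dots> = (\<Sum>k\<le>m. of_nat (Suc n choose k) * iter_diff h k f x)"
    using sum_binomial_Suc[of n "\<lambda>k. iter_diff h k f x" m] assms by simp
  finally show ?case .
qed

lemma frechet_progression_poly:
  assumes "\<And>x. iter_diff h (Suc m) f x = 0"
  obtains q where "\<And>n::nat. f (x + of_nat n * h) = poly q (of_nat n)"
proof -
  obtain B :: "nat \<Rightarrow> real poly" where B: "\<And>k n. poly (B k) (of_nat n) = of_nat (n choose k)"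
    using binomial_polynomial by metis
  show ?thesis
    by (rule that[of "\<Sum>k\<le>m. smult (iter_diff h k f x) (B k)"])
      (subst newton_forward_diff[OF assms], simp add: poly_sum B mult.commute)
qed

text \<open>A progression of step \<open>h / N\<close> refines the one of step \<open>h\<close>; its
  polynomial, rescaled, agrees with \<open>q\<close> at all naturals and so equals \<open>q\<close>.
  Starting the finer progression to the left of \<open>x\<close> covers negative
  \<open>r\<close>.\<close>

lemma frechet_rational_line:
  assumes "\<And>x h. iter_diff h (Suc m) f x = 0"
    and q: "\<And>n::nat. f (x + of_nat n * h) = poly q (of_nat n)"
    and "r \<in> \<rat>"
  shows "f (x + r * h) = poly q r"
proof -
  obtain a :: int and N :: nat where N: "N \<noteq> 0" and r: "r = of_int a / of_nat N"
    using \<open>r \<in> \<rat>\<close> unfolding Rats_eq_int_div_nat by blast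
  \<comment> \<open>Any shift with \<open>a + N * K\<close> nonnegative would do, since this number
    has to be an index of the finer progression.\<close>
  define K where "K = nat \<bar>a\<bar>"
  obtain q' where q': "\<And>n::nat. f (x - of_nat K * h + of_nat n * (h / of_nat N)) = poly q' (of_nat n)"
    using frechet_progression_poly[OF assms(1)] by metis
  \<comment> \<open>The point \<open>x + t * h\<close> has index \<open>N * (t + K)\<close> in the
    finer progression.\<close>
  define q'' where "q'' = pcompose q' [:of_nat (N * K), of_nat N:]"
  have "q'' = q"
  proof (rule poly_eqI_of_nat)
    fix n :: nat
    have "poly q'' (of_nat n) = poly q' (of_nat (N * (n + K)))"
      by (simp add: q''_def poly_pcompose algebra_simps)
    also have "\<dots> = f (x + of_nat n * h)"
      unfolding q'[symmetric] using N by (intro arg_cong[of _ _ f]) (simp add: field_simps)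
    also have "\<dots> = poly q (of_nat n)" by (rule q)
    finally show "poly q'' (of_nat n) = poly q (of_nat n)" .
  qed
  define n where "n = nat (a + int (N * K))"
  have "int K \<le> int (N * K)" using N by (simp only: of_nat_le_iff) simp
  then have "a + int (N * K) \<ge> 0" unfolding K_def by linarith
  then have "of_int (int n) = (of_int (a + int (N * K)) :: real)" unfolding n_def by simp
  then have n: "real n = of_int a + of_nat N * of_nat K" by simp
  have "f (x + r * h) = f (x - of_nat K * h + of_nat n * (h / of_nat N))"
    using N by (intro arg_cong[of _ _ f]) (simp add: n r field_simps)
  also have "\<dots> = poly q'' r"
    unfolding q' using N by (simp add: n r q''_def poly_pcompose algebra_simps)
  finally show ?thesis by (simp add: \<open>q'' = q\<close>)
qed

section \<open>The bivariate polynomial and the closure of the graph\<close>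

lemma iter_diff_rational_line:
  assumes "\<And>x h. \<exists>q. \<forall>r\<in>\<rat>. f (x + r * h) = poly q r"
  shows "\<exists>q. \<forall>r\<in>\<rat>. iter_diff d k f (x + r * h) = poly q r"
proof (induction k arbitrary: x)
  case 0
  then show ?case using assms by simp
next
  case (Suc k)
  obtain p q where "\<forall>r\<in>\<rat>. iter_diff d k f (x + r * h) = poly p r"
    and "\<forall>r\<in>\<rat>. iter_diff d k f ((x + d) + r * h) = poly q r"
    using Suc.IH by meson
  then have "\<forall>r\<in>\<rat>. iter_diff d (Suc k) f (x + r * h) = poly (q - p) r"
    by (simp add: forward_diff_def add.assoc add.commute)
  then show ?case by blast
qed

text \<open>A \<^typ>\<open>real poly poly\<close> \<open>R\<close> stands for the bivariate polynomial
  \<open>(s, v) \<mapsto> poly (poly R [:v:]) s\<close>; the coefficients are polynomials in \<open>s\<close>.\<close>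

lemma poly_poly_linear_substitution:
  fixes B :: "real poly"
  shows "\<exists>R. \<forall>s v. poly (poly R [:v:]) s = poly B (a * s + b * v)"
proof (induction B)
  case 0
  show ?case by (rule exI[of _ 0]) simp
next
  case (pCons c B)
  then obtain R where "\<forall>s v. poly (poly R [:v:]) s = poly B (a * s + b * v)" by blast
  then show ?case
    by (intro exI[of _ "[:[:c:]:] + [:[:0, a:], [:b:]:] * R"]) (simp add: algebra_simps)
qed

text \<open>Newton's formula with step 1 and base point \<open>t * h\<close> expands
  \<open>f (r + t * h)\<close>: the differences at the base point are polynomial in rational
  \<open>t\<close>, the binomials in \<open>r\<close>. The sum is then rewritten in the coordinates
  \<open>s = r + t * h\<close> and \<open>v = t\<close>.\<close>

lemma frechet_bivariate_poly:
  assumes "\<And>x h. iter_diff h (Suc m) f x = 0"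
  obtains R :: "real poly poly"
  where "\<And>r t. r \<in> \<rat> \<Longrightarrow> t \<in> \<rat> \<Longrightarrow> f (r + t * h) = poly (poly R [:t:]) (r + t * h)"
proof -
  have line: "\<exists>q. \<forall>r\<in>\<rat>. f (x + r * h) = poly q r" for x h
    using frechet_progression_poly[OF assms] frechet_rational_line[OF assms] by metis
  obtain B :: "nat \<Rightarrow> real poly" where B: "\<And>k n. poly (B k) (of_nat n) = of_nat (n choose k)"
    using binomial_polynomial by metis
  \<comment> \<open>The argument \<open>s - h * v\<close> is \<open>r\<close> in the new
    coordinates.\<close>
  have "\<exists>R. \<forall>s v. poly (poly R [:v:]) s = poly (B k) (s - h * v)" for k
    using poly_poly_linear_substitution[of "B k" 1 "- h"] by simp
  then obtain C where C: "\<And>k s v. poly (poly (C k) [:v:]) s = poly (B k) (s - h * v)" by metis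
  have "\<exists>R. \<forall>s. \<forall>t\<in>\<rat>. poly (poly R [:t:]) s = iter_diff 1 k f (t * h)" for k
  proof -
    obtain q where q: "\<forall>t\<in>\<rat>. iter_diff 1 k f (0 + t * h) = poly q t"
      using iter_diff_rational_line[OF line] by blast
    then show ?thesis
      using poly_poly_linear_substitution[of q 0 1] by auto
  qed
  then obtain D where D: "\<And>k s t. t \<in> \<rat> \<Longrightarrow> poly (poly (D k) [:t:]) s = iter_diff 1 k f (t * h)"
    by metis
  show ?thesis
  proof (rule that[of "\<Sum>k\<le>m. D k * C k"])
    fix r t :: real
    assume "r \<in> \<rat>" "t \<in> \<rat>"
    have "f (t * h + r * 1) = poly (\<Sum>k\<le>m. smult (iter_diff 1 k f (t * h)) (B k)) r"
      by (rule frechet_rational_line[OF assms _ \<open>r \<in> \<rat>\<close>])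
        (subst newton_forward_diff[OF assms], simp add: poly_sum B mult.commute)
    then show "f (r + t * h) = poly (poly (\<Sum>k\<le>m. D k * C k) [:t:]) (r + t * h)"
      by (simp add: poly_sum D[OF \<open>t \<in> \<rat>\<close>] C algebra_simps)
  qed
qed

lemma poly_poly_sum:
  fixes v s :: real
  shows "poly (poly R [:v:]) s = (\<Sum>k\<le>degree R. poly (coeff R k) s * v ^ k)"
  by (simp add: poly_altdef[of R] poly_sum poly_power)

text \<open>The continuous map \<open>G\<close> sends the dense set of rational pairs into the
  graph, hence the whole plane into its closure. The parameters \<open>(s - v * h, v)\<close> hit
  the required point.\<close>

lemma graph_closure_contains_extension:
  assumes "\<And>r t. r \<in> \<rat> \<Longrightarrow> t \<in> \<rat> \<Longrightarrow> f (r + t * h) = poly (poly R [:t:]) (r + t * h)"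
  shows "(s, poly (poly R [:v:]) s) \<in> closure (fun_graph f)"
proof -
  define G where "G = (\<lambda>(r, t). (r + t * h, poly (poly R [:t:]) (r + t * h)))"
  have "continuous_on UNIV G"
    unfolding G_def poly_poly_sum case_prod_beta by (intro continuous_intros)
  moreover have "G ` (\<rat> \<times> \<rat>) \<subseteq> closure (fun_graph f)"
    using assms closure_subset by (fastforce simp: G_def fun_graph_def)
  ultimately have "G ` closure (\<rat> \<times> \<rat>) \<subseteq> closure (fun_graph f)"
    by (intro image_closure_subset) (auto intro: continuous_on_subset)
  then have "G (s - v * h, v) \<in> closure (fun_graph f)"
    by (auto simp: closure_Times Rats_closure_real)
  then show ?thesis by (simp add: G_def)
qed

section \<open>Ranges and signs of real polynomials\<close>

lemma poly_unbounded_above: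
  fixes p :: "real poly"
  assumes "lead_coeff p > 0" "degree p > 0"
  obtains x where "x > 0" "poly p x \<ge> y"
proof -
  have d: "degree (p - [:y:]) = degree p"
    using degree_add_eq_left[of "- [:y:]" p] assms by (simp only: diff_conv_add_uminus) simp
  then have lc: "lead_coeff (p - [:y:]) = lead_coeff p"
    using assms by (simp add: coeff_pCons split: nat.split)
  then obtain n where "\<forall>x\<ge>n. lead_coeff p \<le> poly (p - [:y:]) x"
    using poly_pinfty_gt_lc[of "p - [:y:]"] assms by auto
  then have "poly p (max n 1) \<ge> lead_coeff p + y"
    by (simp add: algebra_simps)
  then show ?thesis
    using that[of "max n 1"] assms by simp
qed

lemma poly_attains_half_line:
  fixes p :: "real poly"
  assumes "lead_coeff p > 0" "degree p > 0" "y \<ge> poly p 0"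
  shows "\<exists>x. poly p x = y"
proof -
  obtain b where "b > 0" "poly p b \<ge> y"
    using poly_unbounded_above assms by blast
  then show ?thesis
    using IVT'[of "poly p" 0 y b] assms continuous_on_poly[OF continuous_on_id] by auto
qed

text \<open>Finitely many roots leave a root-free interval to the right of \<open>a\<close>, even if
  \<open>a\<close> is itself a root. The sign is read off at the midpoint; a change of sign would
  produce a root.\<close>

lemma poly_sgn_constant_right:
  fixes c :: "real poly"
  assumes "c \<noteq> 0"
  obtains e \<sigma> where "e > 0" "\<sigma> = 1 \<or> \<sigma> = -1" "\<And>s. a < s \<Longrightarrow> s < a + e \<Longrightarrow> \<sigma> * poly c s > 0"
proof -
  obtain e where e: "e > 0" "\<And>s. poly c s = 0 \<Longrightarrow> s \<noteq> a \<Longrightarrow> e \<le> dist a s"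
    using finite_set_avoid[OF poly_roots_finite[OF assms], of a] by auto
  have nz: "poly c s \<noteq> 0" if "a < s" "s < a + e" for s
    using e(2)[of s] that by (auto simp: dist_real_def)
  define \<sigma> where "\<sigma> = sgn (poly c (a + e / 2))"
  have mid: "poly c (a + e / 2) \<noteq> 0" using e(1) by (intro nz) auto
  show ?thesis
  proof (rule that[OF e(1), of \<sigma>])
    show "\<sigma> = 1 \<or> \<sigma> = -1"
      using mid by (auto simp: \<sigma>_def sgn_if)
    fix s assume s: "a < s" "s < a + e"
    show "\<sigma> * poly c s > 0"
    proof (rule ccontr)
      assume "\<not> \<sigma> * poly c s > 0"
      then have neg: "poly c (a + e / 2) * poly c s < 0"
        using mid nz[OF s] by (auto simp: \<sigma>_def sgn_if mult_less_0_iff not_less split: if_splits)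
      then have "s \<noteq> a + e / 2" by (auto simp: not_less)
      then consider "s < a + e / 2" | "a + e / 2 < s" by linarith
      then show False
      proof cases
        case 1
        then obtain x where "s < x" "x < a + e / 2" "poly c x = 0"
          using poly_IVT[of s "a + e / 2" c] neg by (auto simp: mult.commute)
        then show False using nz[of x] s e(1) by simp
      next
        case 2
        then obtain x where "a + e / 2 < x" "x < s" "poly c x = 0"
          using poly_IVT[of "a + e / 2" s c] neg by auto
        then show False using nz[of x] s e(1) by simp
      qed
    qed
  qed
qed

lemma bivariate_attains_half_line:
  fixes R :: "real poly poly"
  assumes deg: "degree R > 0" and \<sigma>: "\<sigma> = 1 \<or> \<sigma> = -1"
    and lc: "\<sigma> * poly (lead_coeff R) s > 0"
    and y: "\<sigma> * y \<ge> \<sigma> * poly (poly R [:0:]) s"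
  shows "\<exists>v. poly (poly R [:v:]) s = y"
proof -
  \<comment> \<open>\<open>T\<close> is \<open>R\<close> at the fixed \<open>s\<close> as a
    polynomial in \<open>v\<close>, multiplied by \<open>\<sigma>\<close> to make its leading
    coefficient positive. As that coefficient does not vanish at \<open>s\<close>, the degree is
    preserved.\<close>
  define T where "T = (\<Sum>k\<le>degree R. monom (\<sigma> * poly (coeff R k) s) k)"
  have T: "poly T v = \<sigma> * poly (poly R [:v:]) s" for v
    by (simp add: T_def poly_poly_sum poly_sum poly_monom sum_distrib_left mult.assoc)
  have coeff_T: "coeff T n = (if n \<le> degree R then \<sigma> * poly (coeff R n) s else 0)" for n
    by (simp add: T_def coeff_sum sum.delta')
  have "degree T = degree R"
    using lc by (intro antisym degree_le le_degree) (auto simp: coeff_T)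
  then have "\<exists>v. poly T v = \<sigma> * y"
    using deg lc y by (intro poly_attains_half_line) (auto simp: coeff_T T)
  then show ?thesis using \<sigma> by (auto simp: T)
qed

section \<open>Half-lines and open regions in the closure\<close>

text \<open>One \<open>\<sigma>\<close> serves the whole interval to the right of \<open>a\<close>.
  This uniformity permits both the limit at \<open>a\<close> itself and an open region.\<close>

lemma frechet_graph_closure_region:
  assumes frechet: "\<And>x h. iter_diff h (Suc m) f x = 0"
    and not_poly: "\<not> ordinary_polynomial f"
  obtains e \<sigma> p where "e > 0" "\<sigma> = 1 \<or> \<sigma> = (-1::real)"
    "\<And>s y. a < s \<Longrightarrow> s < a + e \<Longrightarrow> \<sigma> * y \<ge> \<sigma> * poly p s \<Longrightarrow> (s, y) \<in> closure (fun_graph f)"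
proof -
  obtain p where p: "\<And>n::nat. f (0 + of_nat n * 1) = poly p (of_nat n)"
    using frechet_progression_poly[OF frechet] by metis
  obtain h where h: "f h \<noteq> poly p h"
    using not_poly unfolding ordinary_polynomial_def by blast
  obtain R :: "real poly poly"
    where R: "\<And>r t. r \<in> \<rat> \<Longrightarrow> t \<in> \<rat> \<Longrightarrow> f (r + t * h) = poly (poly R [:t:]) (r + t * h)"
    using frechet_bivariate_poly[OF frechet] by metis
  \<comment> \<open>The slice \<open>v = 0\<close> is \<open>p\<close>, while \<open>r = 0\<close>,
    \<open>t = 1\<close> gives \<open>f h\<close>. These differ at \<open>s = h\<close>, so
    \<open>R\<close> cannot be constant in \<open>v\<close>.\<close>
  have "poly R [:0:] = p"
    using R[of _ 0] p by (intro poly_eqI_of_nat) simp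
  then have "poly (poly R [:1:]) h \<noteq> poly (poly R [:0:]) h"
    using R[of 0 1] h by simp
  then have deg: "degree R > 0"
    by (metis degree_eq_zeroE gr0I mult_zero_right poly_0 poly_pCons add.right_neutral)
  then have "lead_coeff R \<noteq> 0" by auto
  then obtain e \<sigma> where "e > 0" and \<sigma>: "\<sigma> = 1 \<or> \<sigma> = -1"
    and sign: "\<And>s. a < s \<Longrightarrow> s < a + e \<Longrightarrow> \<sigma> * poly (lead_coeff R) s > 0"
    using poly_sgn_constant_right by metis
  show ?thesis
  proof (rule that[OF \<open>e > 0\<close> \<sigma>, of "poly R [:0:]"])
    fix s y assume "a < s" "s < a + e" "\<sigma> * y \<ge> \<sigma> * poly (poly R [:0:]) s"
    then obtain v where "poly (poly R [:v:]) s = y"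
      using bivariate_attains_half_line[OF deg \<sigma> sign] by blast
    then show "(s, y) \<in> closure (fun_graph f)"
      using graph_closure_contains_extension[OF R] by metis
  qed
qed

lemma half_line_unbounded:
  fixes \<sigma> c :: real
  assumes "\<sigma> = 1 \<or> \<sigma> = -1"
  shows "\<not> bounded {y. \<sigma> * y \<ge> \<sigma> * c}"
proof
  assume "bounded {y. \<sigma> * y \<ge> \<sigma> * c}"
  then obtain B where "\<And>y. \<sigma> * y \<ge> \<sigma> * c \<Longrightarrow> \<bar>y\<bar> \<le> B"
    unfolding bounded_iff by auto
  from this[of "\<sigma> * (\<bar>B\<bar> + \<bar>c\<bar> + 1)"] show False
    using assms abs_ge_self[of c] abs_ge_minus_self[of c] abs_ge_self[of B] by fastforce
qed

lemma locally_unbounded_if_closure_unbounded: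
  assumes "\<And>x. \<exists>I. \<not> bounded I \<and> {x} \<times> I \<subseteq> closure (fun_graph f)"
  shows "locally_unbounded f"
  unfolding locally_unbounded_def
proof (intro allI impI notI)
  fix U :: "real set"
  assume U: "open U" "U \<noteq> {}" "bounded (f ` U)"
  then obtain x where "x \<in> U" by blast
  obtain I where I: "\<not> bounded I" "{x} \<times> I \<subseteq> closure (fun_graph f)"
    using assms by blast
  have "I \<subseteq> closure (f ` U)"
  proof
    fix y assume "y \<in> I"
    then have xy: "(x, y) \<in> closure (fun_graph f)" using I by auto
    have "(U \<times> UNIV) \<inter> closure (fun_graph f) \<subseteq> closure ((U \<times> UNIV) \<inter> fun_graph f)"
      by (intro open_Int_closure_subset open_Times U) simp
    then have "(x, y) \<in> closure ((U \<times> UNIV) \<inter> fun_graph f)"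
      using xy \<open>x \<in> U\<close> by blast
    also have "\<dots> \<subseteq> closure (UNIV \<times> f ` U)"
      by (intro closure_mono) (auto simp: fun_graph_def)
    finally show "y \<in> closure (f ` U)" by (simp add: closure_Times)
  qed
  then show False using U I bounded_subset bounded_closure by blast
qed

theorem theorem2p4:
  fixes m :: nat and f :: "real \<Rightarrow> real"
  assumes frechet: "\<forall>x h. iter_diff h (m + 1) f x = 0"
    and not_poly: "\<not> ordinary_polynomial f"
  shows "locally_unbounded f
    \<and> (\<forall>x. \<exists>I :: real set. is_interval I \<and> \<not> bounded I \<and> {x} \<times> I \<subseteq> closure (fun_graph f))
    \<and> (\<exists>W :: (real \<times> real) set. open W \<and> \<not> bounded W \<and> W \<subseteq> closure (fun_graph f))"
proof -
  have "\<And>x h. iter_diff h (Suc m) f x = 0"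
    using frechet by simp
  note region = frechet_graph_closure_region[OF this not_poly]
  have vertical: "\<exists>I :: real set. is_interval I \<and> \<not> bounded I \<and> {a} \<times> I \<subseteq> closure (fun_graph f)" for a
  proof -
    obtain e \<sigma> p where "e > 0" and \<sigma>: "\<sigma> = 1 \<or> \<sigma> = (-1::real)"
      and mem: "\<And>s y. a < s \<Longrightarrow> s < a + e \<Longrightarrow> \<sigma> * y \<ge> \<sigma> * poly p s \<Longrightarrow> (s, y) \<in> closure (fun_graph f)"
      using region by metis
    let ?I = "{y. \<sigma> * y \<ge> \<sigma> * poly p a}"
    have "is_interval ?I"
      using \<sigma> by (auto simp: is_interval_1)
    moreover have "(a, y) \<in> closure (fun_graph f)" if y: "\<sigma> * y \<ge> \<sigma> * poly p a" for y
    proof (rule Lim_in_closed_set[OF closed_closure, of _ _ "at_right a"])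
      \<comment> \<open>The leading coefficient may vanish at \<open>a\<close>, so
        \<open>(a, y)\<close> is reached as a limit from the right. A vertical translate of the
        graph of \<open>p\<close> through \<open>(a, y)\<close> stays on the correct side of
        \<open>p\<close>.\<close>
      let ?g = "\<lambda>s. (s, y - poly p a + poly p s)"
      show "\<forall>\<^sub>F s in at_right a. ?g s \<in> closure (fun_graph f)"
        proof (rule eventually_at_rightI)
        show "?g s \<in> closure (fun_graph f)" if "s \<in> {a<..<a + e}" for s
          using \<sigma> y that by (intro mem) auto
      qed (simp add: \<open>e > 0\<close>)
      have "continuous (at_right a) ?g" by (intro continuous_intros)
      then show "(?g \<longlongrightarrow> (a, y)) (at_right a)" by (simp add: continuous_within)
    qed simp
    ultimately show ?thesis
      using half_line_unbounded[OF \<sigma>] by (intro exI[of _ ?I]) auto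
  qed
  moreover have "locally_unbounded f"
    using vertical by (intro locally_unbounded_if_closure_unbounded) blast
  moreover have "\<exists>W :: (real \<times> real) set. open W \<and> \<not> bounded W \<and> W \<subseteq> closure (fun_graph f)"
  proof -
    obtain e \<sigma> p where "e > 0" and \<sigma>: "\<sigma> = 1 \<or> \<sigma> = (-1::real)"
      and mem: "\<And>s y. 0 < s \<Longrightarrow> s < 0 + e \<Longrightarrow> \<sigma> * y \<ge> \<sigma> * poly p s \<Longrightarrow> (s, y) \<in> closure (fun_graph f)"
      using region by metis
    \<comment> \<open>Strict inequalities make the region open.\<close>
    let ?W = "{z. 0 < fst z \<and> fst z < e \<and> \<sigma> * poly p (fst z) < \<sigma> * snd z}"
    have "open ?W"
      by (intro open_Collect_conj open_Collect_less continuous_intros)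
    moreover have "\<not> bounded ?W"
    proof
      assume "bounded ?W"
      then have "bounded (snd ` ?W)" by (rule bounded_snd)
      \<comment> \<open>Shifting the endpoint by \<open>\<sigma>\<close> adds
        \<open>\<sigma> * \<sigma> = 1\<close> to the bound, which yields the strict inequality in
        \<open>?W\<close>.\<close>
      moreover have "{y. \<sigma> * y \<ge> \<sigma> * (poly p (e / 2) + \<sigma>)} \<subseteq> snd ` ?W"
      proof
        fix y assume "y \<in> {y. \<sigma> * y \<ge> \<sigma> * (poly p (e / 2) + \<sigma>)}"
        then have "(e / 2, y) \<in> ?W" using \<sigma> \<open>e > 0\<close> by auto
        then show "y \<in> snd ` ?W" by (rule rev_image_eqI) simp
      qed
      ultimately show False using half_line_unbounded[OF \<sigma>] bounded_subset by blast
    qed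
    moreover have "?W \<subseteq> closure (fun_graph f)" using mem by auto
    ultimately show ?thesis by blast
  qed
  ultimately show ?thesis by blast
qed

end
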